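(* Let $A$ be a $C^*$-algebra. The closed two-sided ideal $\mathrm{Id}([A,A])$ of $A$ generated by $[A,A]$ agrees with the $C^*$-subalgebra $C^*([A,A])$ of $A$ generated by $[A,A]$. In fact, $\mathrm{Id}([A,A])=\overline{[A,A]+[A,A]^2}$.
   Context: For $x,y\in A$, $[x,y]=xy-yx$. For subsets $X,Y\subseteq A$, $X+Y$, $XY$ and $[X,Y]$ denote the linear spans of the elements $x+y$, $xy$ and $[x,y]$ respectively, with $x\in X$, $y\in Y$; $X^2=XX$. $\mathrm{Id}(X)$ denotes the norm-closed two-sided ideal of $A$ generated by $X$, and $C^*(X)$ the $C^*$-subalgebra of $A$ generated by $X$. The bar denotes norm closure. *)

theory Defs
  imports "HOL-Analysis.Analysis"
begin

text \<open>
  Complex C*-algebras, not assumed to be unital or nonzero. The class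
  \<open>real_normed_algebra\<close> supplies an associative algebra without unit whose norm is
  submultiplicative; \<open>banach\<close> supplies completeness. The complex scalar action extends
  the given real one, and the norm is homogeneous for it.
\<close>

class cstar_algebra = real_normed_algebra + banach +
  fixes scaleC :: "complex \<Rightarrow> 'a \<Rightarrow> 'a"  (infixr \<open>*\<^sub>C\<close> 75)
    and adj :: "'a \<Rightarrow> 'a"  (\<open>_\<^sup>\<star>\<close> [1000] 999)
  assumes scaleC_add_right: "a *\<^sub>C (x + y) = a *\<^sub>C x + a *\<^sub>C y"
    and scaleC_add_left: "(a + b) *\<^sub>C x = a *\<^sub>C x + b *\<^sub>C x"
    and scaleC_scaleC: "a *\<^sub>C b *\<^sub>C x = (a * b) *\<^sub>C x"
    and scaleC_of_real: "complex_of_real r *\<^sub>C x = r *\<^sub>R x"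
    and norm_scaleC: "norm (a *\<^sub>C x) = cmod a * norm x"
    and mult_scaleC_left: "(a *\<^sub>C x) * y = a *\<^sub>C (x * y)"
    and mult_scaleC_right: "x * (a *\<^sub>C y) = a *\<^sub>C (x * y)"
    and adj_adj: "(x\<^sup>\<star>)\<^sup>\<star> = x"
    and adj_add: "(x + y)\<^sup>\<star> = x\<^sup>\<star> + y\<^sup>\<star>"
    and adj_scaleC: "(a *\<^sub>C x)\<^sup>\<star> = cnj a *\<^sub>C x\<^sup>\<star>"
    and adj_mult: "(x * y)\<^sup>\<star> = y\<^sup>\<star> * x\<^sup>\<star>"
    and cstar_identity: "norm (x\<^sup>\<star> * x) = (norm x)\<^sup>2"

global_interpretation complex_vector: vector_space "scaleC :: complex \<Rightarrow> 'a \<Rightarrow> 'a::cstar_algebra"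
  defines csubspace = complex_vector.subspace
    and cspan = complex_vector.span
proof
  fix a b :: complex and x y :: 'a
  show "a *\<^sub>C (x + y) = a *\<^sub>C x + a *\<^sub>C y" by (rule scaleC_add_right)
  show "(a + b) *\<^sub>C x = a *\<^sub>C x + b *\<^sub>C x" by (rule scaleC_add_left)
  show "a *\<^sub>C b *\<^sub>C x = (a * b) *\<^sub>C x" by (rule scaleC_scaleC)
  show "1 *\<^sub>C x = x" using scaleC_of_real[of 1 x] by simp
qed

definition span_plus :: "'a::cstar_algebra set \<Rightarrow> 'a set \<Rightarrow> 'a set" where
  "span_plus X Y = cspan {x + y | x y. x \<in> X \<and> y \<in> Y}"

definition span_times :: "'a::cstar_algebra set \<Rightarrow> 'a set \<Rightarrow> 'a set" where
  "span_times X Y = cspan {x * y | x y. x \<in> X \<and> y \<in> Y}"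

definition span_commutator :: "'a::cstar_algebra set \<Rightarrow> 'a set \<Rightarrow> 'a set" where
  "span_commutator X Y = cspan {x * y - y * x | x y. x \<in> X \<and> y \<in> Y}"

definition closed_two_sided_ideal :: "'a::cstar_algebra set \<Rightarrow> bool" where
  "closed_two_sided_ideal I \<longleftrightarrow>
     csubspace I \<and> closed I \<and> (\<forall>a. \<forall>x\<in>I. a * x \<in> I \<and> x * a \<in> I)"

definition cstar_subalgebra :: "'a::cstar_algebra set \<Rightarrow> bool" where
  "cstar_subalgebra B \<longleftrightarrow>
     csubspace B \<and> closed B \<and> (\<forall>x\<in>B. \<forall>y\<in>B. x * y \<in> B) \<and> (\<forall>x\<in>B. x\<^sup>\<star> \<in> B)"

definition ideal_generated :: "'a::cstar_algebra set \<Rightarrow> 'a set" where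
  "ideal_generated X = closed_two_sided_ideal hull X"

definition cstar_generated :: "'a::cstar_algebra set \<Rightarrow> 'a set" where
  "cstar_generated X = cstar_subalgebra hull X"

end

theory Submission
  imports Defs
begin

text \<open>
  Write \<open>L = [A, A]\<close> and \<open>K\<close> for the closure of \<open>L + L\<^sup>2\<close>. Every closed ideal containing \<open>L\<close>
  contains \<open>K\<close>, and so does every C*-subalgebra containing \<open>L\<close>. The substance is that,
  conversely, \<open>K\<close> contains the closed ideal generated by \<open>L\<close>. As \<open>L\<close> is self-adjoint, so is
  that ideal; hence it is a C*-subalgebra, and all three sets agree.

  By a purely algebraic identity of Herstein, \<open>[l, m] a = [l, m a] - m [l, a]\<close> for \<open>l, m \<in> L\<close>,
  the whole ideal generated by \<open>[L, L]\<close> lies in \<open>L + L\<^sup>2\<close>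
  (\<open>double_commutator_in_ideal_core\<close>). What is left is to see that \<open>[L, L]\<close> generates the
  same closed ideal as \<open>L\<close> (\<open>commutators_in_closed_ideal\<close>): modulo a closed ideal \<open>J\<close>
  containing \<open>[L, L]\<close>, all commutators commute, and one wants \<open>A/J\<close> to be commutative. If
  \<open>D = [a, \<cdot>]\<close> squares to zero modulo \<open>J\<close>, then the Leibniz rule turns \<open>D\<^sup>2 (b\<^sup>2)\<close> into
  \<open>2 (D b)\<^sup>2\<close>, so \<open>[a, b]\<^sup>2 \<in> J\<close>. For self-adjoint \<open>a\<close> and \<open>b\<close> this forces \<open>[a, b] \<in> J\<close>. Applied
  with a commutator in the role of \<open>a\<close> this makes commutators central modulo \<open>J\<close>; applied once
  more, with an arbitrary self-adjoint \<open>a\<close>, it makes them vanish.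

  The only analytic input is that a closed ideal containing the square of a self-adjoint \<open>h\<close>
  contains \<open>h\<close> (\<open>selfadjoint_in_ideal_if_square\<close>). With functional calculus one would
  argue that \<open>(exp(\<i> t h) - 1) / (\<i> t)\<close> is congruent to \<open>h\<close> modulo the ideal and has norm at
  most \<open>2 / t\<close> for every \<open>t > 0\<close>, whence \<open>h\<close> has distance zero from the ideal.
  The exponentials are replaced here by the powers \<open>u\<^sup>N\<close>, \<open>N = 2\<^sup>n\<close>, of the Cayley transform \<open>u\<close> of a multiple of \<open>h\<close>. Since \<open>A\<close> need
  not have a unit, one works with \<open>v = u - 1\<close>; unitarity of \<open>u\<close> then reads \<open>v\<^sup>\<star> v = - v - v\<^sup>\<star>\<close>, and
  the C*-identity gives the bound \<open>2\<close> on the norm of \<open>v\<close> at once.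
\<close>

section \<open>Scalars and the involution\<close>

declare mult_scaleC_left [simp] mult_scaleC_right [simp]

lemma scaleC_two: "2 *\<^sub>C x = x + (x::'a::cstar_algebra)"
  using scaleC_add_left[of 1 1 x] by simp

lemma scaleC_diff_right: "a *\<^sub>C (x - y) = a *\<^sub>C x - a *\<^sub>C (y::'a::cstar_algebra)"
  by (rule complex_vector.scale_right_diff_distrib)

lemma adj_zero [simp]: "(0::'a::cstar_algebra)\<^sup>\<star> = 0"
  using adj_add[of "0::'a" 0] by simp

lemma adj_minus: "(- x)\<^sup>\<star> = - ((x::'a::cstar_algebra)\<^sup>\<star>)"
  using adj_add[of x "- x"] by (simp add: add_eq_0_iff)

lemma adj_diff: "(x - y)\<^sup>\<star> = x\<^sup>\<star> - (y::'a::cstar_algebra)\<^sup>\<star>"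
  using adj_add[of x "- y"] by (simp add: adj_minus)

lemma norm_adj [simp]: "norm ((x::'a::cstar_algebra)\<^sup>\<star>) = norm x"
proof -
  have le: "norm y \<le> norm (y\<^sup>\<star>)" for y :: 'a
  proof (cases "norm y = 0")
    case False
    have "norm y * norm y \<le> norm (y\<^sup>\<star>) * norm y"
      using norm_mult_ineq[of "y\<^sup>\<star>" y] by (simp add: cstar_identity power2_eq_square)
    then show ?thesis using False by (simp add: mult_le_cancel_right)
  qed simp
  show ?thesis using le[of x] le[of "x\<^sup>\<star>"] by (simp add: adj_adj)
qed

lemma continuous_on_adj [continuous_intros]: "continuous_on S (adj :: 'a::cstar_algebra \<Rightarrow> 'a)"
proof -
  have "dist (x\<^sup>\<star>) (y\<^sup>\<star>) = dist x y" for x y :: 'a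
    by (simp add: dist_norm flip: adj_diff)
  then show ?thesis by (simp add: continuous_on_iff) blast
qed

lemma continuous_on_scaleC [continuous_intros]: "continuous_on S ((*\<^sub>C) c :: 'a::cstar_algebra \<Rightarrow> 'a)"
proof -
  have "bounded_linear ((*\<^sub>C) c :: 'a \<Rightarrow> 'a)"
  proof (rule bounded_linear_intro)
    show "c *\<^sub>C (r *\<^sub>R x) = r *\<^sub>R c *\<^sub>C x" for r and x :: 'a
      by (simp add: mult.commute flip: scaleC_of_real)
    show "norm (c *\<^sub>C x) \<le> norm x * cmod c" for x :: 'a by (simp add: norm_scaleC)
  qed (rule scaleC_add_right)
  then show ?thesis by (rule linear_continuous_on)
qed

lemma csubspace_closure:
  fixes S :: "'a::cstar_algebra set"
  assumes "csubspace S" shows "csubspace (closure S)"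
proof (rule complex_vector.subspaceI)
  show "0 \<in> closure S"
    using complex_vector.subspace_0[OF assms] closure_subset by blast
next
  fix x y assume "x \<in> closure S" "y \<in> closure S"
  then obtain f g where "\<forall>n. f n \<in> S" "f \<longlonglongrightarrow> x" "\<forall>n. g n \<in> S" "g \<longlonglongrightarrow> y"
    by (auto simp: closure_sequential)
  then show "x + y \<in> closure S"
    unfolding closure_sequential
    by (intro exI[of _ "\<lambda>n. f n + g n"])
      (auto intro: tendsto_add complex_vector.subspace_add[OF assms])
next
  fix c and x assume "x \<in> closure S"
  moreover have "(*\<^sub>C) c ` closure S \<subseteq> closure S"
    by (rule image_closure_subset[OF continuous_on_scaleC])
      (auto intro: subsetD[OF closure_subset] complex_vector.subspace_scale[OF assms])
  ultimately show "c *\<^sub>C x \<in> closure S" by blast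
qed

lemma selfadjoint_decomposition:
  fixes x :: "'a::cstar_algebra"
  obtains a b where "a\<^sup>\<star> = a" "b\<^sup>\<star> = b" "x = a + \<i> *\<^sub>C b"
proof
  let ?a = "(1/2) *\<^sub>C (x + x\<^sup>\<star>)" and ?b = "(-\<i>/2) *\<^sub>C (x - x\<^sup>\<star>)"
  show "?a\<^sup>\<star> = ?a" by (simp add: adj_scaleC adj_add adj_adj add.commute)
  have "?b\<^sup>\<star> = (\<i>/2) *\<^sub>C (x\<^sup>\<star> - x)" by (simp add: adj_scaleC adj_diff adj_adj adj_minus)
  also have "\<dots> = ?b" by (simp add: scaleC_diff_right)
  finally show "?b\<^sup>\<star> = ?b" .
  have "?a + \<i> *\<^sub>C ?b = (1/2) *\<^sub>C (x + x\<^sup>\<star>) + (1/2) *\<^sub>C (x - x\<^sup>\<star>)" by simp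
  also have "\<dots> = (1/2) *\<^sub>C (x + x)" by (simp flip: scaleC_add_right)
  also have "\<dots> = x" by (simp flip: scaleC_two)
  finally show "x = ?a + \<i> *\<^sub>C ?b" by simp
qed

section \<open>Unitaries without a unit\<close>

text \<open>
  The elements \<open>u - 1\<close> for \<open>u\<close> an isometry in the unitization.
\<close>

definition quasi_isometry :: "'a::cstar_algebra \<Rightarrow> bool" where
  "quasi_isometry v \<longleftrightarrow> v\<^sup>\<star> * v = - v - v\<^sup>\<star>"

lemma norm_quasi_isometry_le:
  fixes v :: "'a::cstar_algebra"
  assumes "quasi_isometry v" shows "norm v \<le> 2"
proof (cases "norm v = 0")
  case False
  have "norm v * norm v = norm (- v - v\<^sup>\<star>)"
    using assms cstar_identity[of v] by (simp add: quasi_isometry_def power2_eq_square)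
  also have "\<dots> \<le> 2 * norm v" using norm_triangle_ineq4[of "- v" "v\<^sup>\<star>"] by simp
  finally show ?thesis using False by (simp add: mult_le_cancel_right)
qed simp

text \<open>\<open>(1 + v)\<^sup>2 - 1 = 2 v + v\<^sup>2\<close>, and squares of isometries are isometries.\<close>

lemma quasi_isometry_square:
  fixes v :: "'a::cstar_algebra"
  assumes "quasi_isometry v" shows "quasi_isometry (v + v + v * v)"
proof -
  let ?w = "v\<^sup>\<star>"
  have q: "?w * v = - v - ?w" using assms by (simp add: quasi_isometry_def)
  have 1: "?w * (v * v) = v + ?w - v * v"
    by (simp add: q left_diff_distrib flip: mult.assoc)
  have 2: "?w * (?w * v) = v + ?w - ?w * ?w"
    by (simp add: q right_diff_distrib)
  have 3: "?w * (?w * (v * v)) = v * v - v - v - ?w - ?w + ?w * ?w"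
    by (simp add: 1 2 q ring_distribs)
  show ?thesis
    by (simp add: quasi_isometry_def adj_add adj_mult ring_distribs mult.assoc q 1 2 3)
qed

text \<open>
  The Cayley transform \<open>u = (1 + \<i> h) (1 - \<i> h)\<^sup>-\<^sup>1\<close> satisfies \<open>u - 1 = \<i> h (u + 1)\<close>, which is the
  fixed point equation below for \<open>v = u - 1\<close>. The bound on \<open>h\<close> makes it a contraction.
\<close>

lemma cayley_transform:
  fixes h :: "'a::cstar_algebra"
  assumes h: "h\<^sup>\<star> = h" and small: "norm h < 1"
  obtains v where "quasi_isometry v" "v = (2 * \<i>) *\<^sub>C h + \<i> *\<^sub>C (h * v)"
proof -
  let ?f = "\<lambda>v. (2 * \<i>) *\<^sub>C h + \<i> *\<^sub>C (h * v)"
  have "\<exists>!v. ?f v = v"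
  proof (rule banach_fix_type[of "norm h"], simp, rule small, intro allI)
    show "dist (?f x) (?f y) \<le> norm h * dist x y" for x y
      using norm_mult_ineq[of h "x - y"]
      by (simp add: dist_norm norm_scaleC ring_distribs flip: scaleC_diff_right)
  qed
  then obtain v where v: "v = ?f v" by metis
  let ?w = "v\<^sup>\<star>"
  have w: "?w = - ((2 * \<i>) *\<^sub>C h) - \<i> *\<^sub>C (?w * h)"
    by (subst v) (simp add: adj_add adj_scaleC adj_mult h complex_vector.scale_minus_left)
  \<comment> \<open>Multiply the equation of \<open>v\<close> by \<open>v\<^sup>\<star>\<close> on the left and its adjoint by \<open>v\<close> on the right: the
    two terms \<open>v\<^sup>\<star> h v\<close> cancel in the sum.\<close>
  have "?w * v = (2 * \<i>) *\<^sub>C (?w * h) + \<i> *\<^sub>C (?w * h * v)"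
    by (subst (2) v) (simp add: distrib_left mult.assoc)
  moreover have "?w * v = - ((2 * \<i>) *\<^sub>C (h * v)) - \<i> *\<^sub>C (?w * h * v)"
    by (subst w) (simp add: left_diff_distrib)
  ultimately have "?w * v + ?w * v = ((2 * \<i>) *\<^sub>C (?w * h) + \<i> *\<^sub>C (?w * h * v))
      + (- ((2 * \<i>) *\<^sub>C (h * v)) - \<i> *\<^sub>C (?w * h * v))"
    by (rule arg_cong2[where f = "(+)"])
  also have "\<dots> = (2 * \<i>) *\<^sub>C (?w * h) - (2 * \<i>) *\<^sub>C (h * v)" by simp
  also have "\<dots> = 2 *\<^sub>C (\<i> *\<^sub>C (?w * h) - \<i> *\<^sub>C (h * v))"
    by (simp add: scaleC_diff_right)
  finally have "2 *\<^sub>C (?w * v) = 2 *\<^sub>C (\<i> *\<^sub>C (?w * h) - \<i> *\<^sub>C (h * v))"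
    by (simp add: scaleC_two)
  then have "?w * v = \<i> *\<^sub>C (?w * h) - \<i> *\<^sub>C (h * v)"
    by (simp add: complex_vector.scale_cancel_left del: mult_scaleC_left mult_scaleC_right)
  also have "\<dots> = - ((2 * \<i>) *\<^sub>C h + \<i> *\<^sub>C (h * v)) - (- ((2 * \<i>) *\<^sub>C h) - \<i> *\<^sub>C (?w * h))"
    by simp
  also have "\<dots> = - v - ?w" by (simp only: v[symmetric] w[symmetric])
  finally have "quasi_isometry v" by (simp add: quasi_isometry_def)
  then show ?thesis using v that by blast
qed

section \<open>Closed ideals contain self-adjoint square roots\<close>

text \<open>
  The elements \<open>v = u\<^sup>N - 1\<close>, with \<open>u\<close> the Cayley transform of \<open>h\<close> and \<open>N = 2\<^sup>n\<close>, are congruent to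
  \<open>2 \<i> N h\<close> modulo the ideal but have norm at most \<open>2\<close>. Dividing by \<open>2 \<i> N\<close> shows that \<open>h\<close> has
  distance at most \<open>1 / N\<close> from the ideal.
\<close>

lemma selfadjoint_contraction_in_ideal_if_square:
  fixes h :: "'a::cstar_algebra"
  assumes I: "closed_two_sided_ideal I" and h: "h\<^sup>\<star> = h" and sq: "h * h \<in> I"
    and small: "norm h < 1"
  shows "h \<in> I"
proof -
  have sub: "csubspace I" and cl: "closed I"
    and ml: "\<And>a x. x \<in> I \<Longrightarrow> a * x \<in> I" and mr: "\<And>a x. x \<in> I \<Longrightarrow> x * a \<in> I"
    using I by (auto simp: closed_two_sided_ideal_def)
  note add = complex_vector.subspace_add[OF sub] and scale = complex_vector.subspace_scale[OF sub]
  \<comment> \<open>Squaring \<open>u\<^sup>N\<close> amounts to replacing \<open>v\<close> by \<open>2 v + v\<^sup>2\<close>; since \<open>v\<^sup>2\<close> lies in the ideal, this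
    doubles the coefficient of \<open>h\<close>.\<close>
  have ex: "\<exists>v w. quasi_isometry v \<and> w \<in> I \<and> v = (2 ^ n * (2 * \<i>)) *\<^sub>C h + w" for n :: nat
  proof (induction n)
    case 0
    obtain v where v: "quasi_isometry v" "v = (2 * \<i>) *\<^sub>C h + \<i> *\<^sub>C (h * v)"
      using cayley_transform[OF h small] .
    have "h * v = (2 * \<i>) *\<^sub>C (h * h) + \<i> *\<^sub>C (h * h * v)"
      by (subst v(2)) (simp add: distrib_left mult.assoc)
    then have "h * v \<in> I" by (simp only:) (intro add scale sq mr[OF sq])
    then have "\<i> *\<^sub>C (h * v) \<in> I" by (rule scale)
    with v show ?case by (metis mult_1 power_0)
  next
    case (Suc n)
    then obtain v w where vw: "quasi_isometry v" "w \<in> I" "v = (2 ^ n * (2 * \<i>)) *\<^sub>C h + w" by blast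
    define c where "c = (2 ^ n * (2 * \<i>) :: complex)"
    have v: "v = c *\<^sub>C h + w" using vw(3) by (simp add: c_def)
    have "v * v = (c * c) *\<^sub>C (h * h) + c *\<^sub>C (h * w) + w * v"
      by (simp add: v ring_distribs scaleC_add_right add.assoc)
    also have "\<dots> \<in> I" by (intro add scale sq ml[OF vw(2)] mr[OF vw(2)])
    finally have "w + w + v * v \<in> I" by (intro add vw(2))
    moreover have "v + v = (c + c) *\<^sub>C h + (w + w)"
      by (simp only: v scaleC_add_left add_ac)
    then have "v + v + v * v = (c + c) *\<^sub>C h + (w + w + v * v)"
      by (simp only: add.assoc[symmetric])
    moreover have "c + c = 2 ^ Suc n * (2 * \<i>)" by (simp add: c_def)
    ultimately show ?case using quasi_isometry_square[OF vw(1)] by metis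
  qed
  have "h \<in> closure I"
    unfolding closure_approachable
  proof (intro allI impI)
    fix e :: real assume "0 < e"
    then obtain n where n: "(1/2) ^ n < e" using real_arch_pow_inv[of e "1/2"] by auto
    obtain v w where vw: "quasi_isometry v" "w \<in> I" "v = (2 ^ n * (2 * \<i>)) *\<^sub>C h + w"
      using ex by blast
    define c where "c = (2 ^ n * (2 * \<i>) :: complex)"
    have [simp]: "c \<noteq> 0" and normc: "cmod c = 2 ^ n * 2" by (simp_all add: c_def norm_mult norm_power)
    have "h - (- inverse c) *\<^sub>C w = inverse c *\<^sub>C v"
      by (simp add: vw(3) scaleC_add_right complex_vector.scale_minus_left flip: c_def)
    then have "norm (h - (- inverse c) *\<^sub>C w) = norm v / (2 ^ n * 2)"
      by (simp only: norm_scaleC norm_inverse normc divide_inverse mult.commute)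
    also have "\<dots> \<le> 2 / (2 ^ n * 2)"
      by (rule divide_right_mono[OF norm_quasi_isometry_le[OF vw(1)]]) simp
    also have "\<dots> = (1/2) ^ n" by (simp add: power_one_over)
    finally have "dist ((- inverse c) *\<^sub>C w) h < e"
      using n by (simp add: dist_norm norm_minus_commute)
    then show "\<exists>y\<in>I. dist y h < e" using scale[OF vw(2)] by blast
  qed
  then show ?thesis using cl by simp
qed

text \<open>Rescaling removes the bound on the norm.\<close>

lemma selfadjoint_in_ideal_if_square:
  fixes h :: "'a::cstar_algebra"
  assumes I: "closed_two_sided_ideal I" and h: "h\<^sup>\<star> = h" and sq: "h * h \<in> I"
  shows "h \<in> I"
proof -
  define s where "s = 1 / (norm h + 1)"
  define r where "r = complex_of_real s"
  have "norm h + 1 > 0" using norm_ge_zero[of h] by linarith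
  then have "s > 0" "s * norm h < 1" by (simp_all add: s_def)
  then have r: "r \<noteq> 0" "cnj r = r" "norm (r *\<^sub>C h) < 1"
    by (simp_all add: r_def norm_scaleC)
  have sub: "csubspace I" using I by (simp add: closed_two_sided_ideal_def)
  have "r *\<^sub>C h \<in> I"
  proof (rule selfadjoint_contraction_in_ideal_if_square[OF I])
    show "(r *\<^sub>C h)\<^sup>\<star> = r *\<^sub>C h" by (simp only: adj_scaleC h r(2))
    show "(r *\<^sub>C h) * (r *\<^sub>C h) \<in> I"
      using complex_vector.subspace_scale[OF sub sq, of "r * r"] by simp
  qed (rule r(3))
  from complex_vector.subspace_scale[OF sub this, of "inverse r"] show ?thesis using r(1) by simp
qed

section \<open>Commutators modulo a closed ideal\<close>

definition commutator :: "'a::cstar_algebra \<Rightarrow> 'a \<Rightarrow> 'a" where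
  "commutator x y = x * y - y * x"

lemma commutator_add_left: "commutator (x + y) z = commutator x z + commutator y z"
  and commutator_add_right: "commutator z (x + y) = commutator z x + commutator z y"
  and commutator_scaleC_left: "commutator (c *\<^sub>C x) z = c *\<^sub>C commutator x z"
  and commutator_scaleC_right: "commutator z (c *\<^sub>C x) = c *\<^sub>C commutator z x"
  by (simp_all add: commutator_def algebra_simps scaleC_diff_right)

lemma adj_commutator: "(commutator x y)\<^sup>\<star> = commutator (y\<^sup>\<star>) (x\<^sup>\<star>)"
  by (simp add: commutator_def adj_diff adj_mult)

lemma commutator_minus_swap: "commutator y x = - commutator x y"
  by (simp add: commutator_def)

text \<open>The factor \<open>\<i>\<close> corrects for the commutator of self-adjoint elements being skew-adjoint.\<close>

lemma adj_i_commutator: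
  assumes "a\<^sup>\<star> = a" "b\<^sup>\<star> = b" shows "(\<i> *\<^sub>C commutator a b)\<^sup>\<star> = \<i> *\<^sub>C commutator a b"
  by (simp add: adj_scaleC adj_commutator assms) (simp add: commutator_def scaleC_diff_right)

text \<open>
  For the derivation \<open>D = [a, \<cdot>]\<close>, Leibniz gives \<open>D\<^sup>2 (b b) = D\<^sup>2 b b + 2 (D b)\<^sup>2 + b D\<^sup>2 b\<close>. So
  \<open>(D b)\<^sup>2\<close> lies in the ideal, and \<open>\<i> D b\<close> is self-adjoint.
\<close>

lemma commutator_in_ideal_if_ad_square:
  fixes a b :: "'a::cstar_algebra"
  assumes J: "closed_two_sided_ideal J" and a: "a\<^sup>\<star> = a" and b: "b\<^sup>\<star> = b"
    and ad2: "\<And>x. commutator a (commutator a x) \<in> J"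
  shows "commutator a b \<in> J"
proof -
  have sub: "csubspace J" and ml: "\<And>a x. x \<in> J \<Longrightarrow> a * x \<in> J" and mr: "\<And>a x. x \<in> J \<Longrightarrow> x * a \<in> J"
    using J by (auto simp: closed_two_sided_ideal_def)
  note diff = complex_vector.subspace_diff[OF sub] and scale = complex_vector.subspace_scale[OF sub]
  let ?D = "commutator a"
  have "?D b * ?D b + ?D b * ?D b = ?D (?D (b * b)) - ?D (?D b) * b - b * ?D (?D b)"
    by (simp add: commutator_def ring_distribs mult.assoc)
  also have "\<dots> \<in> J" by (intro diff ad2 ml[OF ad2] mr[OF ad2])
  finally have "2 *\<^sub>C (?D b * ?D b) \<in> J" by (simp only: scaleC_two)
  from scale[OF this, of "- 1 / 2"] have "(\<i> *\<^sub>C ?D b) * (\<i> *\<^sub>C ?D b) \<in> J" by simp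
  then have "\<i> *\<^sub>C ?D b \<in> J"
    by (intro selfadjoint_in_ideal_if_square[OF J adj_i_commutator[OF a b]])
  from scale[OF this, of "- \<i>"] show ?thesis by simp
qed

text \<open>
  The double commutator hypothesis gives \<open>[c, [c, x]] \<in> J\<close> for every commutator \<open>c\<close>, so that
  commutators are central modulo \<open>J\<close>. But then \<open>[a, [a, x]] \<in> J\<close> for every \<open>a\<close>.
\<close>

lemma commutators_in_closed_ideal:
  fixes J :: "'a::cstar_algebra set"
  assumes J: "closed_two_sided_ideal J"
    and dbl: "\<And>a b c d. commutator (commutator a b) (commutator c d) \<in> J"
  shows "commutator x y \<in> J"
proof -
  have sub: "csubspace J" using J by (simp add: closed_two_sided_ideal_def)
  note add = complex_vector.subspace_add[OF sub] and scale = complex_vector.subspace_scale[OF sub]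
  have central_sa: "commutator (commutator p q) b \<in> J" if "p\<^sup>\<star> = p" "q\<^sup>\<star> = q" "b\<^sup>\<star> = b" for p q b
  proof -
    let ?c = "\<i> *\<^sub>C commutator p q"
    have "commutator ?c b \<in> J"
    proof (rule commutator_in_ideal_if_ad_square[OF J adj_i_commutator])
      show "commutator ?c (commutator ?c x) \<in> J" for x
        unfolding commutator_scaleC_left commutator_scaleC_right by (intro scale dbl)
    qed (use that in auto)
    from scale[OF this, of "- \<i>"] show ?thesis by (simp add: commutator_scaleC_left)
  qed
  have central: "commutator (commutator p q) b \<in> J" for p q b
  proof -
    obtain p1 p2 where p: "p1\<^sup>\<star> = p1" "p2\<^sup>\<star> = p2" "p = p1 + \<i> *\<^sub>C p2" by (rule selfadjoint_decomposition)
    obtain q1 q2 where q: "q1\<^sup>\<star> = q1" "q2\<^sup>\<star> = q2" "q = q1 + \<i> *\<^sub>C q2" by (rule selfadjoint_decomposition)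
    obtain b1 b2 where b: "b1\<^sup>\<star> = b1" "b2\<^sup>\<star> = b2" "b = b1 + \<i> *\<^sub>C b2" by (rule selfadjoint_decomposition)
    show ?thesis
      unfolding p(3) q(3) b(3) commutator_add_left commutator_add_right
        commutator_scaleC_left commutator_scaleC_right
      by (intro add scale central_sa p q b)
  qed
  have sa: "commutator a b \<in> J" if "a\<^sup>\<star> = a" "b\<^sup>\<star> = b" for a b
  proof (rule commutator_in_ideal_if_ad_square[OF J that])
    show "commutator a (commutator a z) \<in> J" for z
      using complex_vector.subspace_neg[OF sub central[of a z a]]
      by (simp flip: commutator_minus_swap)
  qed
  obtain x1 x2 where x: "x1\<^sup>\<star> = x1" "x2\<^sup>\<star> = x2" "x = x1 + \<i> *\<^sub>C x2" by (rule selfadjoint_decomposition)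
  obtain y1 y2 where y: "y1\<^sup>\<star> = y1" "y2\<^sup>\<star> = y2" "y = y1 + \<i> *\<^sub>C y2" by (rule selfadjoint_decomposition)
  show ?thesis
    unfolding x(3) y(3) commutator_add_left commutator_add_right
      commutator_scaleC_left commutator_scaleC_right
    by (intro add scale sa x y)
qed

section \<open>The ideal generated by double commutators\<close>

text \<open>For a subspace \<open>K\<close>, this is the largest two-sided ideal inside \<open>K\<close>.\<close>

definition ideal_core :: "'a::cstar_algebra set \<Rightarrow> 'a set" where
  "ideal_core K = {z \<in> K. (\<forall>a. a * z \<in> K) \<and> (\<forall>b. z * b \<in> K) \<and> (\<forall>a b. a * z * b \<in> K)}"

lemma closed_ideal_core:
  fixes K :: "'a::cstar_algebra set"
  assumes sub: "csubspace K" and cl: "closed K"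
  shows "closed_two_sided_ideal (ideal_core K)"
  unfolding closed_two_sided_ideal_def
proof (intro conjI allI ballI)
  show "csubspace (ideal_core K)"
    by (rule complex_vector.subspaceI)
      (auto simp: ideal_core_def ring_distribs intro: complex_vector.subspace_add[OF sub]
        complex_vector.subspace_scale[OF sub] complex_vector.subspace_0[OF sub])
  have "ideal_core K = K \<inter> (\<Inter>a. (\<lambda>z. a * z) -` K) \<inter> (\<Inter>b. (\<lambda>z. z * b) -` K)
      \<inter> (\<Inter>a. \<Inter>b. (\<lambda>z. a * z * b) -` K)"
    by (auto simp: ideal_core_def)
  then show "closed (ideal_core K)"
    using cl by (auto intro!: closed_Int closed_INT closed_vimage continuous_intros)
qed (auto simp: ideal_core_def mult.assoc, auto simp flip: mult.assoc)

text \<open>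
  Herstein's identities \<open>[l, m] a = [l, m a] - m [l, a]\<close> and \<open>b z = [b, z] + z b\<close> express all
  elements of the ideal generated by \<open>[l, m]\<close> through commutators and products of two of them.
\<close>

lemma double_commutator_in_ideal_core:
  fixes K :: "'a::cstar_algebra set"
  assumes sub: "csubspace K"
    and comm: "\<And>x y. commutator x y \<in> K"
    and prod: "\<And>a b c d. commutator a b * commutator c d \<in> K"
  shows "commutator (commutator a b) (commutator c d) \<in> ideal_core K"
proof -
  let ?l = "commutator a b" and ?m = "commutator c d"
  let ?z = "commutator ?l ?m"
  note add = complex_vector.subspace_add[OF sub] and diff = complex_vector.subspace_diff[OF sub]
  have r: "?z * x \<in> K" for x
  proof -
    have "?z * x = commutator ?l (?m * x) - ?m * commutator ?l x"
      unfolding commutator_def[of ?l] by (simp add: algebra_simps)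
    then show ?thesis by (simp only:) (intro diff comm prod)
  qed
  have l: "x * ?z \<in> K" for x
  proof -
    have "x * ?z = commutator x ?z + ?z * x" by (simp add: commutator_def[of x])
    then show ?thesis by (simp only:) (intro add comm r)
  qed
  have lr: "x * ?z * y \<in> K" for x y
  proof -
    have "x * ?z * y = commutator x (?z * y) + ?z * (y * x)"
      by (simp add: commutator_def[of x] mult.assoc)
    then show ?thesis by (simp only:) (intro add comm r)
  qed
  show ?thesis by (simp add: ideal_core_def comm l r lr)
qed

section \<open>Generated ideals\<close>

lemma closed_two_sided_ideal_ideal_generated: "closed_two_sided_ideal (ideal_generated X)"
  unfolding ideal_generated_def
proof (rule hull_in)
  fix T :: "'a set set" assume *: "\<forall>s\<in>T. closed_two_sided_ideal s"
  show "closed_two_sided_ideal (\<Inter>T)"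
    unfolding closed_two_sided_ideal_def
  proof (intro conjI allI ballI)
    show "csubspace (\<Inter>T)"
      by (rule complex_vector.subspace_Inter) (use * in \<open>auto simp: closed_two_sided_ideal_def\<close>)
  qed (use * in \<open>auto simp: closed_two_sided_ideal_def\<close>)
qed

lemma cstar_subalgebra_cstar_generated: "cstar_subalgebra (cstar_generated X)"
  unfolding cstar_generated_def
proof (rule hull_in)
  fix T :: "'a set set" assume *: "\<forall>s\<in>T. cstar_subalgebra s"
  show "cstar_subalgebra (\<Inter>T)"
    unfolding cstar_subalgebra_def
  proof (intro conjI allI ballI)
    show "csubspace (\<Inter>T)"
      by (rule complex_vector.subspace_Inter) (use * in \<open>auto simp: cstar_subalgebra_def\<close>)
  qed (use * in \<open>auto simp: cstar_subalgebra_def\<close>)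
qed

text \<open>The involution carries closed ideals to closed ideals, so it preserves the one generated by a
  self-adjoint set.\<close>

lemma cstar_subalgebra_ideal_generated:
  fixes X :: "'a::cstar_algebra set"
  assumes X: "\<And>x. x \<in> X \<Longrightarrow> x\<^sup>\<star> \<in> X"
  shows "cstar_subalgebra (ideal_generated X)"
proof -
  let ?I = "ideal_generated X"
  have I: "csubspace ?I" "closed ?I" "\<And>a x. x \<in> ?I \<Longrightarrow> a * x \<in> ?I" "\<And>a x. x \<in> ?I \<Longrightarrow> x * a \<in> ?I"
    using closed_two_sided_ideal_ideal_generated[of X] by (auto simp: closed_two_sided_ideal_def)
  have "closed_two_sided_ideal (adj -` ?I)"
    unfolding closed_two_sided_ideal_def
  proof (intro conjI allI ballI)
    show "csubspace (adj -` ?I)"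
      by (rule complex_vector.subspaceI)
        (auto simp: adj_add adj_scaleC intro: complex_vector.subspace_add[OF I(1)]
          complex_vector.subspace_scale[OF I(1)] complex_vector.subspace_0[OF I(1)])
  qed (use I in \<open>auto simp: adj_mult intro!: closed_vimage continuous_intros\<close>)
  moreover have "X \<subseteq> adj -` ?I"
    using X hull_subset[of X closed_two_sided_ideal] by (auto simp: ideal_generated_def)
  ultimately have "?I \<subseteq> adj -` ?I"
    by (simp add: ideal_generated_def hull_minimal)
  then show ?thesis using I by (auto simp: cstar_subalgebra_def)
qed

lemma span_commutator_eq: "span_commutator UNIV UNIV = cspan {commutator x y | x y. True}"
  by (simp add: span_commutator_def commutator_def)

lemma span_commutator_subset:
  fixes S :: "'a::cstar_algebra set"
  assumes "csubspace S" "\<And>x y. commutator x y \<in> S"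
  shows "span_commutator UNIV UNIV \<subseteq> S"
  unfolding span_commutator_eq using assms by (intro complex_vector.span_minimal) auto

lemma adj_span_commutator:
  fixes x :: "'a::cstar_algebra"
  assumes "x \<in> span_commutator UNIV UNIV" shows "x\<^sup>\<star> \<in> span_commutator UNIV UNIV"
  using assms unfolding span_commutator_eq
proof (induction rule: complex_vector.span_induct_alt)
  case base
  show ?case by (simp add: complex_vector.span_zero)
next
  case (step c x y)
  then have "x\<^sup>\<star> \<in> cspan {commutator x y | x y. True}"
    by (auto simp: adj_commutator intro!: complex_vector.span_base) blast
  with step show ?case
    by (simp add: adj_add adj_scaleC complex_vector.span_add complex_vector.span_scale)
qed

section \<open>The ideal generated by commutators\<close>

lemma closure_span_plus_times_subset:
  fixes S X :: "'a::cstar_algebra set"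
  assumes "csubspace S" "closed S" "X \<subseteq> S" "\<And>x y. x \<in> S \<Longrightarrow> y \<in> S \<Longrightarrow> x * y \<in> S"
  shows "closure (span_plus X (span_times X X)) \<subseteq> S"
proof -
  have "span_times X X \<subseteq> S"
    unfolding span_times_def using assms by (intro complex_vector.span_minimal) auto
  then have "span_plus X (span_times X X) \<subseteq> S"
    unfolding span_plus_def using assms
    by (intro complex_vector.span_minimal) (auto intro!: complex_vector.subspace_add)
  then show ?thesis using assms(2) by (rule closure_minimal)
qed

theorem theorem1p3:
  shows "ideal_generated (span_commutator UNIV (UNIV :: 'a::cstar_algebra set))
      = cstar_generated (span_commutator UNIV (UNIV :: 'a set))
    \<and> ideal_generated (span_commutator UNIV (UNIV :: 'a set))
      = closure (span_plus (span_commutator UNIV (UNIV :: 'a set))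
          (span_times (span_commutator UNIV (UNIV :: 'a set)) (span_commutator UNIV (UNIV :: 'a set))))"
proof -
  let ?L = "span_commutator UNIV (UNIV :: 'a set)"
  let ?M = "span_plus ?L (span_times ?L ?L)"
  let ?K = "closure ?M"
  have L0: "0 \<in> ?L" by (simp add: span_commutator_def complex_vector.span_zero)
  have T0: "0 \<in> span_times ?L ?L" by (simp add: span_times_def complex_vector.span_zero)
  have commL: "commutator x y \<in> ?L" for x y
    unfolding span_commutator_eq by (rule complex_vector.span_base) blast
  have "x + y \<in> ?M" if "x \<in> ?L" "y \<in> span_times ?L ?L" for x y
    unfolding span_plus_def by (rule complex_vector.span_base) (use that in blast)
  from this[OF _ T0] this[OF L0]
  have LM: "?L \<subseteq> ?M" and TM: "span_times ?L ?L \<subseteq> ?M" by auto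
  have prodT: "x * y \<in> span_times ?L ?L" if "x \<in> ?L" "y \<in> ?L" for x y
    unfolding span_times_def by (rule complex_vector.span_base) (use that in blast)
  have subK: "csubspace ?K"
    by (rule csubspace_closure) (simp add: span_plus_def complex_vector.subspace_span)
  have core: "closed_two_sided_ideal (ideal_core ?K)"
    by (rule closed_ideal_core[OF subK closed_closure])
  have "commutator x y \<in> ideal_core ?K" for x y
  proof (rule commutators_in_closed_ideal[OF core double_commutator_in_ideal_core[OF subK]])
    show "commutator x y \<in> ?K" for x y
      using commL LM closure_subset by blast
    show "commutator a b * commutator c d \<in> ?K" for a b c d
      using prodT[OF commL commL] TM closure_subset by blast
  qed
  then have "?L \<subseteq> ideal_core ?K"
    using core by (intro span_commutator_subset) (auto simp: closed_two_sided_ideal_def)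
  then have "ideal_generated ?L \<subseteq> ideal_core ?K"
    unfolding ideal_generated_def using core by (rule hull_minimal)
  then have Id_K: "ideal_generated ?L \<subseteq> ?K" by (auto simp: ideal_core_def)
  have K_C: "?K \<subseteq> cstar_generated ?L"
    using cstar_subalgebra_cstar_generated[of ?L] hull_subset[of ?L cstar_subalgebra]
    by (intro closure_span_plus_times_subset) (auto simp: cstar_subalgebra_def cstar_generated_def)
  have C_Id: "cstar_generated ?L \<subseteq> ideal_generated ?L"
    using hull_subset[of ?L closed_two_sided_ideal] cstar_subalgebra_ideal_generated[OF adj_span_commutator]
    unfolding cstar_generated_def ideal_generated_def by (intro hull_minimal) auto
  show ?thesis using Id_K K_C C_Id by auto
qed

end
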